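(* Let $\mathbf S=(S,\vee)$ be a join semilattice and let $\Gamma$ be the function which sends a compatible preorder $\sqsubseteq$ on $\mathbf S$ to the (isomorphism class of the) quotient $(\pi_{\sqsubseteq}, \mathbf S/\Theta_{\sqsubseteq})$, where $\Theta_{\sqsubseteq}$ is the congruence on $\mathbf S$ defined by $a \mathrel{\Theta_{\sqsubseteq}} b$ iff both $a\sqsubseteq b$ and $b\sqsubseteq a$, and $\pi_{\sqsubseteq}: S\to S/\Theta_{\sqsubseteq}$ is the canonical projection. Then $\Gamma$ is a bijection from the set of compatible preorders on $\mathbf S$ to the set of equivalence classes of quotients of $\mathbf S$ up to isomorphism.
   Context: For a join semilattice $\mathbf S=(S,\vee)$, let $\leq$ be the induced order ($a\leq b$ iff $a\vee b=b$). A preorder (reflexive and transitive relation) $\sqsubseteq$ on $S$ is called compatible if it is coarser than $\leq$ (that is, $a\leq b$ implies $a\sqsubseteq b$) and, for all $a,a_1,b\in S$, $a\sqsubseteq b$ and $a_1\sqsubseteq b$ imply $a\vee a_1\sqsubseteq b$. For such $\sqsubseteq$, the relation $\Theta_{\sqsubseteq}$ is a semilattice congruence, so the quotient semilattice $\mathbf S/\Theta_{\sqsubseteq}$ makes sense. A quotient of $\mathbf S$ is a pair $(\varphi,\mathbf T)$ where $\mathbf T$ is a join semilattice and $\varphi:\mathbf S\to\mathbf T$ is a surjective semilattice homomorphism. Two quotients $(\varphi,\mathbf T)$ and $(\varphi',\mathbf T')$ of $\mathbf S$ are isomorphic if there is a semilattice isomorphism $\chi:\mathbf T\to\mathbf T'$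 such that $\chi(\varphi(s))=\varphi'(s)$ for every $s\in S$. *)

theory Defs
  imports "HOL-Library.FuncSet"
begin

record 'a semilat =
  carrier :: "'a set"
  join :: "'a \<Rightarrow> 'a \<Rightarrow> 'a" (infixl "\<squnion>\<index>" 65)

locale join_semilattice =
  fixes S :: "'a semilat" (structure)
  assumes join_closed: "\<lbrakk>a \<in> carrier S; b \<in> carrier S\<rbrakk> \<Longrightarrow> a \<squnion> b \<in> carrier S"
    and join_assoc: "\<lbrakk>a \<in> carrier S; b \<in> carrier S; c \<in> carrier S\<rbrakk>
      \<Longrightarrow> (a \<squnion> b) \<squnion> c = a \<squnion> (b \<squnion> c)"
    and join_comm: "\<lbrakk>a \<in> carrier S; b \<in> carrier S\<rbrakk> \<Longrightarrow> a \<squnion> b = b \<squnion> a"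
    and join_idem: "a \<in> carrier S \<Longrightarrow> a \<squnion> a = a"

definition induced_le :: "'a semilat \<Rightarrow> 'a rel" where
  "induced_le S = {(a, b). a \<in> carrier S \<and> b \<in> carrier S \<and> a \<squnion>\<^bsub>S\<^esub> b = b}"

definition compatible :: "'a semilat \<Rightarrow> 'a rel \<Rightarrow> bool" where
  "compatible S r \<longleftrightarrow>
     preorder_on (carrier S) r \<and>
     induced_le S \<subseteq> r \<and>
     (\<forall>a\<in>carrier S. \<forall>a1\<in>carrier S. \<forall>b\<in>carrier S.
        (a, b) \<in> r \<and> (a1, b) \<in> r \<longrightarrow> (a \<squnion>\<^bsub>S\<^esub> a1, b) \<in> r)"

definition semilat_hom :: "'a semilat \<Rightarrow> 'b semilat \<Rightarrow> ('a \<Rightarrow> 'b) set" where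
  "semilat_hom S T =
     {f \<in> carrier S \<rightarrow> carrier T.
        \<forall>a\<in>carrier S. \<forall>b\<in>carrier S. f (a \<squnion>\<^bsub>S\<^esub> b) = f a \<squnion>\<^bsub>T\<^esub> f b}"

definition semilat_iso :: "'a semilat \<Rightarrow> 'b semilat \<Rightarrow> ('a \<Rightarrow> 'b) set" where
  "semilat_iso S T = {f \<in> semilat_hom S T. bij_betw f (carrier S) (carrier T)}"

definition quotients :: "'a semilat \<Rightarrow> (('a \<Rightarrow> 'b) \<times> 'b semilat) set" where
  "quotients S =
     {(\<phi>, T). join_semilattice T \<and> \<phi> \<in> semilat_hom S T \<and> \<phi> ` carrier S = carrier T}"

text \<open>The two quotients may live over different types. Values of the homomorphisms outside
  the carrier of \<open>S\<close> are ignored.\<close>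

definition isomorphic_quotients ::
    "'a semilat \<Rightarrow> ('a \<Rightarrow> 'b) \<times> 'b semilat \<Rightarrow> ('a \<Rightarrow> 'c) \<times> 'c semilat \<Rightarrow> bool" where
  "isomorphic_quotients S = (\<lambda>(\<phi>, T) (\<phi>', T').
     \<exists>\<chi>\<in>semilat_iso T T'. \<forall>s\<in>carrier S. \<chi> (\<phi> s) = \<phi>' s)"

definition quotient_iso_rel :: "'a semilat \<Rightarrow> (('a \<Rightarrow> 'b) \<times> 'b semilat) rel" where
  "quotient_iso_rel S =
     {(Q, Q'). Q \<in> quotients S \<and> Q' \<in> quotients S \<and> isomorphic_quotients S Q Q'}"

definition Theta :: "'a semilat \<Rightarrow> 'a rel \<Rightarrow> 'a rel" where
  "Theta S r = {(a, b). a \<in> carrier S \<and> b \<in> carrier S \<and> (a, b) \<in> r \<and> (b, a) \<in> r}"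

text \<open>For a congruence \<open>\<theta>\<close> the union below collapses to the single class of
  \<open>a \<squnion> b\<close>, for any representatives \<open>a\<close>, \<open>b\<close>.\<close>

definition quotient_semilat :: "'a semilat \<Rightarrow> 'a rel \<Rightarrow> 'a set semilat" where
  "quotient_semilat S \<theta> =
     \<lparr>carrier = carrier S // \<theta>,
      join = (\<lambda>A B. \<Union>a\<in>A. \<Union>b\<in>B. \<theta> `` {a \<squnion>\<^bsub>S\<^esub> b})\<rparr>"

definition canonical_quotient ::
    "'a semilat \<Rightarrow> 'a rel \<Rightarrow> ('a \<Rightarrow> 'a set) \<times> 'a set semilat" where
  "canonical_quotient S r = (\<lambda>a. Theta S r `` {a}, quotient_semilat S (Theta S r))"

text \<open>Isomorphism classes are formed among the quotients with elements in \<^typ>\<open>'a set\<close>, a type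
  large enough to contain a copy of every quotient of a semilattice over \<^typ>\<open>'a\<close>.\<close>

definition Gamma ::
    "'a semilat \<Rightarrow> 'a rel \<Rightarrow> (('a \<Rightarrow> 'a set) \<times> 'a set semilat) set" where
  "Gamma S r = quotient_iso_rel S `` {canonical_quotient S r}"

context join_semilattice
begin

lemma join_le:
  assumes "a \<in> carrier S" "b \<in> carrier S"
  shows "(a, a \<squnion> b) \<in> induced_le S" "(b, a \<squnion> b) \<in> induced_le S"
proof -
  show "(a, a \<squnion> b) \<in> induced_le S"
    unfolding induced_le_def using assms join_closed join_assoc[of a a b] join_idem by simp
  have "b \<squnion> (a \<squnion> b) = a \<squnion> b"
    using assms join_closed join_assoc[of a b b] join_idem join_comm by metis
  then show "(b, a \<squnion> b) \<in> induced_le S"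
    unfolding induced_le_def using assms join_closed by simp
qed

lemma Theta_congruence:
  assumes "compatible S r"
  shows "equiv (carrier S) (Theta S r)"
    and "\<lbrakk>(a, a') \<in> Theta S r; (b, b') \<in> Theta S r\<rbrakk> \<Longrightarrow> (a \<squnion> b, a' \<squnion> b') \<in> Theta S r"
proof -
  have r: "refl_on (carrier S) r" "trans r" and le: "induced_le S \<subseteq> r"
    using assms by (auto simp: compatible_def preorder_on_def)
  have up: "(a \<squnion> a1, b) \<in> r"
    if "a \<in> carrier S" "a1 \<in> carrier S" "b \<in> carrier S" "(a, b) \<in> r" "(a1, b) \<in> r" for a a1 b
    using assms that by (auto simp: compatible_def)
  show "equiv (carrier S) (Theta S r)"
    using r by (auto simp: equiv_def Theta_def refl_on_def sym_def intro!: transI dest: transD)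
  have mono: "(a \<squnion> b, a' \<squnion> b') \<in> r"
    if "a \<in> carrier S" "b \<in> carrier S" "a' \<in> carrier S" "b' \<in> carrier S"
      "(a, a') \<in> r" "(b, b') \<in> r" for a a' b b'
  proof (rule up)
    show "(a, a' \<squnion> b') \<in> r" "(b, a' \<squnion> b') \<in> r"
      using that join_le[of a' b'] le r(2) by (meson subsetD transD)+
  qed (use that join_closed in auto)
  show "\<lbrakk>(a, a') \<in> Theta S r; (b, b') \<in> Theta S r\<rbrakk> \<Longrightarrow> (a \<squnion> b, a' \<squnion> b') \<in> Theta S r"
    using mono join_closed by (auto simp: Theta_def)
qed

end

lemma isomorphic_quotients_refl: "isomorphic_quotients S Q Q"
  by (cases Q) (auto simp: isomorphic_quotients_def semilat_iso_def semilat_hom_def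
      intro!: bexI[of _ "\<lambda>x. x"] bij_betw_id[unfolded id_def])

lemma isomorphic_quotients_sym:
  assumes "Q \<in> quotients S" "isomorphic_quotients S Q Q'"
  shows "isomorphic_quotients S Q' Q"
proof -
  obtain \<phi> T \<phi>' T' where Q: "Q = (\<phi>, T)" "Q' = (\<phi>', T')" by (cases Q, cases Q') auto
  obtain \<chi> where \<chi>: "\<chi> \<in> semilat_hom T T'" and b: "bij_betw \<chi> (carrier T) (carrier T')"
    and c: "\<forall>s\<in>carrier S. \<chi> (\<phi> s) = \<phi>' s"
    using assms(2) by (auto simp: Q isomorphic_quotients_def semilat_iso_def)
  have T: "join_semilattice T" and img: "\<phi> ` carrier S = carrier T"
    using assms(1) by (auto simp: Q quotients_def)
  let ?\<psi> = "inv_into (carrier T) \<chi>"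
  have b': "bij_betw ?\<psi> (carrier T') (carrier T)" using b by (rule bij_betw_inv_into)
  have "?\<psi> (x \<squnion>\<^bsub>T'\<^esub> y) = ?\<psi> x \<squnion>\<^bsub>T\<^esub> ?\<psi> y"
    if "x \<in> carrier T'" "y \<in> carrier T'" for x y
  proof -
    have m: "?\<psi> x \<in> carrier T" "?\<psi> y \<in> carrier T" using b' that by (auto dest: bij_betwE)
    have "\<chi> (?\<psi> x \<squnion>\<^bsub>T\<^esub> ?\<psi> y) = x \<squnion>\<^bsub>T'\<^esub> y"
      using \<chi> m that b by (auto simp: semilat_hom_def bij_betw_inv_into_right)
    then show ?thesis
      using bij_betw_inv_into_left[OF b join_semilattice.join_closed[OF T m]] by simp
  qed
  then have "?\<psi> \<in> semilat_iso T' T"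
    using b' by (auto simp: semilat_iso_def semilat_hom_def dest: bij_betwE)
  moreover have "\<forall>s\<in>carrier S. ?\<psi> (\<phi>' s) = \<phi> s"
    using c img bij_betw_inv_into_left[OF b] by (metis imageI)
  ultimately show ?thesis by (auto simp: Q isomorphic_quotients_def)
qed

lemma isomorphic_quotients_trans:
  assumes "isomorphic_quotients S Q Q'" "isomorphic_quotients S Q' Q''"
  shows "isomorphic_quotients S Q Q''"
proof -
  obtain \<phi> T \<phi>' T' \<phi>'' T'' where Q: "Q = (\<phi>, T)" "Q' = (\<phi>', T')" "Q'' = (\<phi>'', T'')"
    by (cases Q, cases Q', cases Q'') auto
  obtain \<chi> \<chi>' where h: "\<chi> \<in> semilat_hom T T'" "\<chi>' \<in> semilat_hom T' T''"
    and b: "bij_betw \<chi> (carrier T) (carrier T')" "bij_betw \<chi>' (carrier T') (carrier T'')"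
    and c: "\<forall>s\<in>carrier S. \<chi> (\<phi> s) = \<phi>' s" "\<forall>s\<in>carrier S. \<chi>' (\<phi>' s) = \<phi>'' s"
    using assms by (auto simp: Q isomorphic_quotients_def semilat_iso_def)
  have "\<chi>' \<circ> \<chi> \<in> semilat_iso T T''"
    using h bij_betw_trans[OF b] by (auto simp: semilat_iso_def semilat_hom_def Pi_iff)
  moreover have "\<forall>s\<in>carrier S. (\<chi>' \<circ> \<chi>) (\<phi> s) = \<phi>'' s" using c by simp
  ultimately show ?thesis unfolding Q isomorphic_quotients_def prod.case
    by (intro bexI[of _ "\<chi>' \<circ> \<chi>"])
qed

lemma equiv_quotient_iso_rel: "equiv (quotients S) (quotient_iso_rel S)"
proof (rule equivI)
  show "quotient_iso_rel S \<subseteq> quotients S \<times> quotients S"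
    by (auto simp: quotient_iso_rel_def)
  show "refl_on (quotients S) (quotient_iso_rel S)"
    by (auto simp: refl_on_def quotient_iso_rel_def isomorphic_quotients_refl)
  show "sym (quotient_iso_rel S)"
    by (auto simp: sym_def quotient_iso_rel_def intro: isomorphic_quotients_sym)
  show "trans (quotient_iso_rel S)"
    unfolding trans_def quotient_iso_rel_def
    by (clarify, blast intro: isomorphic_quotients_trans)
qed

end

theory Submission
  imports Defs
begin

text \<open>
  The inverse of \<open>\<Gamma>\<close> pulls the order of \<open>\<^bold>T\<close> back along \<open>\<phi>\<close>: a quotient \<open>(\<phi>, \<^bold>T)\<close> of
  \<open>\<^bold>S\<close> is sent to the preorder \<open>a \<sqsubseteq> b \<longleftrightarrow> \<phi> a \<le> \<phi> b\<close>. This preorder is compatible because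
  \<open>\<phi>\<close> preserves joins (\<open>compatible_pullback_le\<close>), and it determines the quotient up to
  isomorphism (\<open>isomorphic_quotients_iff_pullback_le\<close>): antisymmetry of \<open>\<le>\<close> recovers the kernel
  of \<open>\<phi>\<close>, and a surjective homomorphism is determined by its kernel.

  The only computation is that pulling back along the projection
  \<open>\<pi>\<^sub>\<sqsubseteq>\<close> returns \<open>\<sqsubseteq>\<close> (\<open>pullback_le_canonical\<close>). Once this is known, \<open>\<^bold>S/\<Theta>\<^sub>\<sqsubseteq>\<close> is isomorphic to
  a quotient exactly when \<open>\<sqsubseteq>\<close> is the pulled-back preorder of that quotient
  (\<open>canonical_isomorphic_iff\<close>). So each quotient, over whatever type its elements live,
  comes from exactly one compatible preorder, and both claims follow. The first isomorphism
  theorem does not have to be proved separately: it is the comparison of \<open>(\<phi>, \<^bold>T)\<close> with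
  \<open>\<^bold>S/\<Theta>\<^sub>\<sqsubseteq>\<close>, two quotients with the same pulled-back preorder.
\<close>

lemma (in join_semilattice) induced_le_antisym:
  assumes "(a, b) \<in> induced_le S" "(b, a) \<in> induced_le S"
  shows "a = b"
  using assms join_comm by (force simp: induced_le_def)

lemma (in join_semilattice) compatible_induced_le: "compatible S (induced_le S)"
proof -
  have "trans (induced_le S)"
  proof (rule transI)
    fix a b c assume "(a, b) \<in> induced_le S" "(b, c) \<in> induced_le S"
    then show "(a, c) \<in> induced_le S"
      using join_assoc[of a b c] by (auto simp: induced_le_def)
  qed
  moreover have "refl_on (carrier S) (induced_le S)"
    by (auto simp: refl_on_def induced_le_def join_idem)
  moreover have "(a \<squnion> a1, b) \<in> induced_le S"
    if "(a, b) \<in> induced_le S" "(a1, b) \<in> induced_le S" for a a1 b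
    using that join_assoc[of a a1 b] join_closed by (auto simp: induced_le_def)
  ultimately show ?thesis
    by (auto simp: compatible_def preorder_on_def induced_le_def)
qed

definition pullback_le :: "'a semilat \<Rightarrow> ('a \<Rightarrow> 'b) \<times> 'b semilat \<Rightarrow> 'a rel" where
  "pullback_le S = (\<lambda>(\<phi>, T).
     {(a, b). a \<in> carrier S \<and> b \<in> carrier S \<and> (\<phi> a, \<phi> b) \<in> induced_le T})"

lemma compatible_pullback_le:
  assumes "join_semilattice S" "Q \<in> quotients S"
  shows "compatible S (pullback_le S Q)"
proof -
  obtain \<phi> T where Q: "Q = (\<phi>, T)" by (cases Q)
  interpret S: join_semilattice S by fact
  interpret T: join_semilattice T using assms(2) by (auto simp: Q quotients_def)
  have in_T: "\<phi> a \<in> carrier T" if "a \<in> carrier S" for a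
    using assms(2) that by (auto simp: Q quotients_def)
  have hom: "\<phi> (a \<squnion>\<^bsub>S\<^esub> b) = \<phi> a \<squnion>\<^bsub>T\<^esub> \<phi> b" if "a \<in> carrier S" "b \<in> carrier S" for a b
    using assms(2) that by (auto simp: Q quotients_def semilat_hom_def)
  have r: "refl_on (carrier T) (induced_le T)" "trans (induced_le T)"
    and up: "\<And>a a1 b. \<lbrakk>a \<in> carrier T; a1 \<in> carrier T; b \<in> carrier T; (a, b) \<in> induced_le T;
      (a1, b) \<in> induced_le T\<rbrakk> \<Longrightarrow> (a \<squnion>\<^bsub>T\<^esub> a1, b) \<in> induced_le T"
    using T.compatible_induced_le by (auto simp: compatible_def preorder_on_def)
  have "preorder_on (carrier S) (pullback_le S Q)"
    using r in_T by (auto simp: preorder_on_def Q pullback_le_def refl_on_def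
        intro!: transI dest: transD)
  moreover have "induced_le S \<subseteq> pullback_le S Q"
  proof (clarsimp simp: Q pullback_le_def induced_le_def in_T)
    fix a b assume "a \<in> carrier S" "b \<in> carrier S" "a \<squnion>\<^bsub>S\<^esub> b = b"
    then show "\<phi> a \<squnion>\<^bsub>T\<^esub> \<phi> b = \<phi> b" by (metis hom)
  qed
  ultimately show ?thesis
    using up by (auto simp: compatible_def Q pullback_le_def hom in_T S.join_closed)
qed

lemma hom_eq_iff_pullback_le:
  assumes "(\<phi>, T) \<in> quotients S" "a \<in> carrier S" "b \<in> carrier S"
  shows "\<phi> a = \<phi> b \<longleftrightarrow>
    (a, b) \<in> pullback_le S (\<phi>, T) \<and> (b, a) \<in> pullback_le S (\<phi>, T)"
proof -
  interpret T: join_semilattice T using assms(1) by (auto simp: quotients_def)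
  have "\<phi> b \<in> carrier T" using assms by (auto simp: quotients_def)
  then have "(\<phi> b, \<phi> b) \<in> induced_le T" by (simp add: induced_le_def T.join_idem)
  then show ?thesis using assms by (auto simp: pullback_le_def intro: T.induced_le_antisym)
qed

text \<open>For the harder direction, equal preorders give equal kernels, so sending \<open>\<phi> s\<close> to
  \<open>\<phi>' s\<close> is well defined and injective.\<close>

lemma isomorphic_quotients_iff_pullback_le:
  assumes S: "join_semilattice S" and Q: "Q \<in> quotients S" and Q': "Q' \<in> quotients S"
  shows "isomorphic_quotients S Q Q' \<longleftrightarrow> pullback_le S Q = pullback_le S Q'"
proof -
  obtain \<phi> T \<phi>' T' where eq: "Q = (\<phi>, T)" "Q' = (\<phi>', T')" by (cases Q, cases Q')
  have img: "carrier T = \<phi> ` carrier S" "carrier T' = \<phi>' ` carrier S"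
    and hom: "\<And>a b. \<lbrakk>a \<in> carrier S; b \<in> carrier S\<rbrakk> \<Longrightarrow> \<phi> (a \<squnion>\<^bsub>S\<^esub> b) = \<phi> a \<squnion>\<^bsub>T\<^esub> \<phi> b"
      "\<And>a b. \<lbrakk>a \<in> carrier S; b \<in> carrier S\<rbrakk> \<Longrightarrow> \<phi>' (a \<squnion>\<^bsub>S\<^esub> b) = \<phi>' a \<squnion>\<^bsub>T'\<^esub> \<phi>' b"
    using Q Q' by (auto simp: eq quotients_def semilat_hom_def)
  show ?thesis
  proof
    assume "isomorphic_quotients S Q Q'"
    then obtain \<chi> where \<chi>: "\<chi> \<in> semilat_hom T T'" "inj_on \<chi> (carrier T)"
      and c: "\<And>s. s \<in> carrier S \<Longrightarrow> \<phi>' s = \<chi> (\<phi> s)"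
      by (auto simp: eq isomorphic_quotients_def semilat_iso_def bij_betw_def)
    have "\<phi> a \<squnion>\<^bsub>T\<^esub> \<phi> b = \<phi> b \<longleftrightarrow> \<phi>' a \<squnion>\<^bsub>T'\<^esub> \<phi>' b = \<phi>' b"
      if ab: "a \<in> carrier S" "b \<in> carrier S" for a b
    proof -
      have mem: "\<phi> (a \<squnion>\<^bsub>S\<^esub> b) \<in> carrier T" "\<phi> b \<in> carrier T"
        using ab join_semilattice.join_closed[OF S] by (auto simp: img)
      have "\<phi> (a \<squnion>\<^bsub>S\<^esub> b) = \<phi> b \<longleftrightarrow> \<phi>' (a \<squnion>\<^bsub>S\<^esub> b) = \<phi>' b"
        using inj_on_eq_iff[OF \<chi>(2) mem] c ab join_semilattice.join_closed[OF S] by simp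
      then show ?thesis using ab by (simp add: hom)
    qed
    then show "pullback_le S Q = pullback_le S Q'"
      by (auto simp: eq pullback_le_def induced_le_def img)
  next
    assume same: "pullback_le S Q = pullback_le S Q'"
    have ker: "\<phi> a = \<phi> b \<longleftrightarrow> \<phi>' a = \<phi>' b" if "a \<in> carrier S" "b \<in> carrier S" for a b
      using same hom_eq_iff_pullback_le[OF Q[unfolded eq] that]
        hom_eq_iff_pullback_le[OF Q'[unfolded eq] that] by (simp add: eq)
    define \<chi> where "\<chi> = \<phi>' \<circ> inv_into (carrier S) \<phi>"
    have \<chi>: "\<chi> (\<phi> s) = \<phi>' s" if "s \<in> carrier S" for s
    proof -
      have "inv_into (carrier S) \<phi> (\<phi> s) \<in> carrier S"
        "\<phi> (inv_into (carrier S) \<phi> (\<phi> s)) = \<phi> s"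
        using that by (auto intro: inv_into_into f_inv_into_f)
      then show ?thesis using that by (simp add: \<chi>_def ker)
    qed
    have "bij_betw \<chi> (carrier T) (carrier T')"
      by (rule bij_betw_imageI) (auto simp: img inj_on_def \<chi> ker image_image)
    moreover have "\<chi> \<in> semilat_hom T T'"
      using join_semilattice.join_closed[OF S]
      by (auto simp: semilat_hom_def img \<chi> hom(2) simp flip: hom(1))
    ultimately show "isomorphic_quotients S Q Q'"
      using \<chi> by (auto simp: eq isomorphic_quotients_def semilat_iso_def)
  qed
qed

context join_semilattice
begin

lemma Theta_class_eq_iff:
  assumes "compatible S r" "a \<in> carrier S" "b \<in> carrier S"
  shows "Theta S r `` {a} = Theta S r `` {b} \<longleftrightarrow> (a, b) \<in> Theta S r"
  using Theta_congruence(1)[OF assms(1)] assms(2,3) by (rule eq_equiv_class_iff)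

lemma join_quotient_semilat:
  assumes r: "compatible S r" and a: "a \<in> carrier S" and b: "b \<in> carrier S"
  shows "Theta S r `` {a} \<squnion>\<^bsub>quotient_semilat S (Theta S r)\<^esub> Theta S r `` {b} =
    Theta S r `` {a \<squnion> b}"
proof -
  have E: "equiv (carrier S) (Theta S r)" using r by (rule Theta_congruence)
  have "congruent2 (Theta S r) (Theta S r) (\<lambda>x y. Theta S r `` {x \<squnion> y})"
    unfolding congruent2_def using equiv_class_eq[OF E] Theta_congruence(2)[OF r] by blast
  from UN_equiv_class2[OF E E this a b] show ?thesis
    by (simp add: quotient_semilat_def)
qed

lemma canonical_quotient_in_quotients:
  assumes r: "compatible S r"
  shows "canonical_quotient S r \<in> quotients S"
proof -
  let ?T = "quotient_semilat S (Theta S r)" and ?\<pi> = "\<lambda>a. Theta S r `` {a}"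
  have carr: "carrier ?T = ?\<pi> ` carrier S"
    by (auto simp: quotient_semilat_def quotient_def)
  have "join_semilattice ?T"
  proof
    show "x \<squnion>\<^bsub>?T\<^esub> y = y \<squnion>\<^bsub>?T\<^esub> x" if "x \<in> carrier ?T" "y \<in> carrier ?T" for x y
      using that by (auto simp only: carr join_quotient_semilat[OF r] join_comm)
  qed (auto simp: carr join_quotient_semilat[OF r] join_closed join_assoc join_idem)
  moreover have "?\<pi> \<in> semilat_hom S ?T"
    by (auto simp: semilat_hom_def carr join_quotient_semilat[OF r])
  ultimately show ?thesis by (simp add: quotients_def canonical_quotient_def carr)
qed

text \<open>The class of \<open>a\<close> lies below the class of \<open>b\<close> iff \<open>a \<squnion> b\<close> and \<open>b\<close> are equivalent. Since
  \<open>b \<sqsubseteq> a \<squnion> b\<close> always, this says \<open>a \<squnion> b \<sqsubseteq> b\<close>, which is equivalent to \<open>a \<sqsubseteq> b\<close>: it implies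
  \<open>a \<sqsubseteq> b\<close> by transitivity through \<open>a \<sqsubseteq> a \<squnion> b\<close>, and it follows from \<open>a \<sqsubseteq> b\<close> and \<open>b \<sqsubseteq> b\<close> by
  the join axiom of a compatible preorder.\<close>

lemma pullback_le_canonical:
  assumes r: "compatible S r"
  shows "pullback_le S (canonical_quotient S r) = r"
proof -
  have sub: "r \<subseteq> carrier S \<times> carrier S" and refl: "refl_on (carrier S) r"
    and trans: "trans r" and le: "induced_le S \<subseteq> r"
    using r by (auto simp: compatible_def preorder_on_def)
  have "(a \<squnion> b, b) \<in> Theta S r \<longleftrightarrow> (a, b) \<in> r"
    if ab: "a \<in> carrier S" "b \<in> carrier S" for a b
  proof -
    have up: "(a, a \<squnion> b) \<in> r" "(b, a \<squnion> b) \<in> r" using join_le[OF ab] le by auto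
    have "(a \<squnion> b, b) \<in> r" if "(a, b) \<in> r"
      using r ab that refl_onD[OF refl ab(2)] by (auto simp: compatible_def)
    moreover have "(a, b) \<in> r" if "(a \<squnion> b, b) \<in> r"
      using trans up(1) that by (rule transD)
    ultimately show ?thesis using ab up by (auto simp: Theta_def join_closed)
  qed
  then have "(a, b) \<in> pullback_le S (canonical_quotient S r) \<longleftrightarrow> (a, b) \<in> r"
    if "a \<in> carrier S" "b \<in> carrier S" for a b
    using that by (auto simp: pullback_le_def canonical_quotient_def induced_le_def
        join_quotient_semilat[OF r] Theta_class_eq_iff[OF r] join_closed
        quotient_semilat_def[THEN arg_cong[where f = carrier]] intro: quotientI)
  then show ?thesis using sub by (auto simp: pullback_le_def canonical_quotient_def)
qed

lemma canonical_isomorphic_iff: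
  assumes "compatible S r" "Q \<in> quotients S"
  shows "isomorphic_quotients S (canonical_quotient S r) Q \<longleftrightarrow> r = pullback_le S Q"
  using isomorphic_quotients_iff_pullback_le[OF join_semilattice_axioms
      canonical_quotient_in_quotients[OF assms(1)] assms(2)]
  by (simp add: pullback_le_canonical[OF assms(1)])

lemma bij_betw_Gamma:
  "bij_betw (Gamma S) {r. compatible S r} (quotients S // quotient_iso_rel S)"
proof (rule bij_betw_imageI)
  have Gamma_eq: "Gamma S r = quotient_iso_rel S `` {Q} \<longleftrightarrow> r = pullback_le S Q"
    if "compatible S r" "Q \<in> quotients S" for r Q
  proof -
    have mem: "canonical_quotient S r \<in> quotients S"
      using that(1) by (rule canonical_quotient_in_quotients)
    have "Gamma S r = quotient_iso_rel S `` {Q} \<longleftrightarrow>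
        (canonical_quotient S r, Q) \<in> quotient_iso_rel S"
      unfolding Gamma_def using equiv_quotient_iso_rel mem that(2) by (rule eq_equiv_class_iff)
    then show ?thesis
      using mem that by (simp add: quotient_iso_rel_def canonical_isomorphic_iff)
  qed
  show "inj_on (Gamma S) {r. compatible S r}"
  proof (rule inj_onI)
    fix r r' assume "r \<in> {r. compatible S r}" "r' \<in> {r. compatible S r}" "Gamma S r = Gamma S r'"
    then show "r = r'"
      using Gamma_eq[of r "canonical_quotient S r'"]
      by (simp add: Gamma_def canonical_quotient_in_quotients pullback_le_canonical)
  qed
  show "Gamma S ` {r. compatible S r} = quotients S // quotient_iso_rel S"
  proof (intro equalityI subsetI)
    fix X assume "X \<in> Gamma S ` {r. compatible S r}"
    then show "X \<in> quotients S // quotient_iso_rel S"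
      by (auto simp: Gamma_def intro: quotientI canonical_quotient_in_quotients)
  next
    fix X :: "(('a \<Rightarrow> 'a set) \<times> 'a set semilat) set"
    assume "X \<in> quotients S // quotient_iso_rel S"
    then obtain Q where "Q \<in> quotients S" "X = quotient_iso_rel S `` {Q}"
      by (rule quotientE)
    then show "X \<in> Gamma S ` {r. compatible S r}"
      using Gamma_eq compatible_pullback_le[OF join_semilattice_axioms] by blast
  qed
qed

end

theorem corollary2p3:
  fixes S :: "'a semilat"
  assumes "join_semilattice S"
  shows "bij_betw (Gamma S) {r. compatible S r} (quotients S // quotient_iso_rel S)
       \<and> (\<forall>Q \<in> (quotients S :: (('a \<Rightarrow> 'b) \<times> 'b semilat) set).
            \<exists>!r. compatible S r \<and> isomorphic_quotients S (canonical_quotient S r) Q)"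
proof -
  interpret join_semilattice S by fact
  show ?thesis
    using bij_betw_Gamma canonical_isomorphic_iff compatible_pullback_le[OF assms] by blast
qed

end
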